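(* Let $A_1,A_2,Z$ be finite subsets of $\mathbb{R}$ with $|A_1|\le |A_2|$ and $|Z|\lesssim |A_1|^2$. Then \[ R(Z;A_1,A_2)\lesssim |A_1|^{10/3}|A_2|^{8/3}, \] where the implied constants may depend on the implied constant in the hypothesis $|Z|\lesssim|A_1|^2$.
   Context: $R(Z;A_1,A_2)$ is the number of 8-tuples $(a_1,a_2,a_1',a_2',a_1'',a_2'',a_1''',a_2''')$ with $a_i,a_i',a_i'',a_i'''\in A_i$ ($i=1,2$) and nonzero denominators such that \[ \frac{a_1+a_2}{a_1'+a_2'}=\frac{a_1''+a_2''}{a_1'''+a_2'''}\in Z . \] Notation: $X\lesssim Y$ means $X\le C\,Y(\log(2+N))^{c}$ for some absolute constants $C,c>0$, where $N$ is the largest cardinality of the finite sets in the statement; $X\gtrsim Y$ means $Y\lesssim X$. *)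

theory Defs
  imports Complex_Main
begin

definition Rcount :: "real set \<Rightarrow> real set \<Rightarrow> real set \<Rightarrow> nat" where
  "Rcount Z A1 A2 = card
     {(a1, a2, b1, b2, c1, c2, d1, d2).
        (a1::real) \<in> A1 \<and> a2 \<in> A2 \<and> b1 \<in> A1 \<and> b2 \<in> A2 \<and>
        c1 \<in> A1 \<and> c2 \<in> A2 \<and> d1 \<in> A1 \<and> d2 \<in> A2 \<and>
        b1 + b2 \<noteq> 0 \<and> d1 + d2 \<noteq> 0 \<and>
        (a1 + a2) / (b1 + b2) = (c1 + c2) / (d1 + d2) \<and>
        (a1 + a2) / (b1 + b2) \<in> Z}"

end

(* Write n_A(z, c) for the number of points of A \<times> A on the line y = z x + c. The number
   r(z) of solutions of a1 + a2 = z (b1 + b2) equals \<Sum>\<^sub>c n_{A1}(z, c) n_{-A2}(z, c), and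
   R \<le> \<Sum>_{z \<in> Z} r(z)^2. As \<Sum>\<^sub>c n_{A1}(z, c) \<le> |A1|^2, Cauchy-Schwarz gives
   R \<le> |A1|^2 \<Sum>_{z, c} n_{A1} n_{-A2}^2, and a Hoelder-type inequality reduces the claim to
   \<Sum>_{z, c} n_A(z, c)^3 \<lesssim> |A|^4. For this it suffices that O(|A|^4 / k^3) lines are k-rich.
   For k = 1 this is the hypothesis on |Z|. For k \<ge> 2 it is the Szemeredi-Trotter bound, which
   for a grid is elementary: cut A \<times> A into about (k/16)^2 cells. A k-rich line meets only k/8
   or so of them, so it has at least k/2 pairs of points in a common cell, each pair determines
   the line, and there are O(|A|^4 / k^2) such pairs in all. *)

theory Submission
  imports Defs "HOL-Analysis.Analysis"
begin

section \<open>Lines in a Cartesian grid and cells of consecutive elements\<close>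

definition line_pts :: "real set \<Rightarrow> real \<Rightarrow> real \<Rightarrow> real set" where
  "line_pts A z c = {b \<in> A. z * b + c \<in> A}"

lemma finite_line_pts [simp]: "finite A \<Longrightarrow> finite (line_pts A z c)"
  by (simp add: line_pts_def)

lemma card_line_pts_le: "finite A \<Longrightarrow> card (line_pts A z c) \<le> card A"
  by (rule card_mono) (auto simp: line_pts_def)

text \<open>Zero-based position in increasing order, extended to all reals. The fibres of
  \<open>rank_in A a div m\<close> on \<open>A\<close> are blocks of at most \<open>m\<close>
  consecutive elements; their products are the cells of \<open>A \<times> A\<close>.\<close>

definition rank_in :: "real set \<Rightarrow> real \<Rightarrow> nat" where
  "rank_in A a = card {x \<in> A. x < a}"

lemma rank_in_mono: "finite A \<Longrightarrow> a \<le> b \<Longrightarrow> rank_in A a \<le> rank_in A b"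
  unfolding rank_in_def by (rule card_mono) auto

lemma rank_in_less:
  assumes "finite A" "a \<in> A" "a < b"
  shows "rank_in A a < rank_in A b"
  unfolding rank_in_def using assms by (intro psubset_card_mono) auto

lemma inj_on_rank_in: "finite A \<Longrightarrow> inj_on (rank_in A) A"
  by (metis inj_onI less_irrefl linorder_neqE rank_in_less)

lemma rank_in_less_card:
  assumes "finite A" "a \<in> A"
  shows "rank_in A a < card A"
  unfolding rank_in_def using assms by (intro psubset_card_mono) auto

lemma card_rank_cell_le:
  assumes "finite A" "m > 0"
  shows "card {a \<in> A. rank_in A a div m = q} \<le> m"
proof -
  have "card {a \<in> A. rank_in A a div m = q} \<le> card {q * m..<q * m + m}"
  proof (rule card_inj_on_le)
    show "inj_on (rank_in A) {a \<in> A. rank_in A a div m = q}"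
      using inj_on_rank_in[OF assms(1)] by (rule inj_on_subset) auto
    show "rank_in A ` {a \<in> A. rank_in A a div m = q} \<subseteq> {q * m..<q * m + m}"
    proof clarify
      fix a
      have "rank_in A a < m + rank_in A a div m * m"
        using assms(2) by (rule dividend_less_div_times)
      then show "rank_in A a \<in> {rank_in A a div m * m..<rank_in A a div m * m + m}"
        by (simp add: add.commute)
    qed
  qed auto
  then show ?thesis by simp
qed

lemma card_same_cell_pairs:
  assumes "finite A" "m > 0"
  shows "card {(x, x') \<in> A \<times> A. rank_in A x div m = rank_in A x' div m} \<le> card A * m"
proof -
  have "{(x, x') \<in> A \<times> A. rank_in A x div m = rank_in A x' div m}
      = (SIGMA x:A. {a \<in> A. rank_in A a div m = rank_in A x div m})"
    by auto
  then have "card {(x, x') \<in> A \<times> A. rank_in A x div m = rank_in A x' div m}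
      = (\<Sum>x\<in>A. card {a \<in> A. rank_in A a div m = rank_in A x div m})"
    using assms by simp
  also have "\<dots> \<le> (\<Sum>x\<in>A. m)"
    by (intro sum_mono card_rank_cell_le assms)
  finally show ?thesis by simp
qed

text \<open>Each nonempty fibre of \<open>g\<close> has exactly one maximal element, so no more
  points are lost than \<open>g\<close> has values.\<close>

lemma card_nonmaximal_in_fibre:
  fixes X :: "real set"
  assumes "finite X"
  shows "card X \<le> card {x \<in> X. \<exists>x'\<in>X. x < x' \<and> g x = g x'} + card (g ` X)"
proof -
  let ?N = "{x \<in> X. \<exists>x'\<in>X. x < x' \<and> g x = g x'}"
  have "inj_on g (X - ?N)"
    by (rule inj_onI) (metis (mono_tags, lifting) DiffE linorder_neqE mem_Collect_eq)
  then have "card (X - ?N) \<le> card (g ` X)"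
    by (rule card_inj_on_le) (use assms in auto)
  moreover have "card (X - ?N) = card X - card ?N"
    by (rule card_Diff_subset) (use assms in auto)
  ultimately show ?thesis by linarith
qed

text \<open>A line is monotone, so it meets at most \<open>2M + 1\<close> of the cells of an
  \<open>(M + 1) \<times> (M + 1)\<close> array.\<close>

lemma same_cell_points_on_line:
  fixes m :: nat
  assumes "finite A"
  defines "M \<equiv> (card A - 1) div m"
  shows "card (line_pts A z c) \<le> card {x \<in> line_pts A z c. \<exists>x'\<in>line_pts A z c. x < x'
           \<and> rank_in A x div m = rank_in A x' div m
           \<and> rank_in A (z * x + c) div m = rank_in A (z * x' + c) div m} + (2 * M + 1)"
proof -
  define cell where "cell = (\<lambda>a. rank_in A a div m)"
  \<comment> \<open>Along the line both cell indices are monotone; for negative slope the second is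
    reflected so that both increase. Equal sums then force both indices to agree, and the sum takes
    at most \<open>2 * M + 1\<close> values.\<close>
  define g where "g = (\<lambda>x. cell x + (if z \<ge> 0 then cell (z * x + c) else M - cell (z * x + c)))"
  have cell_le: "cell a \<le> M" if "a \<in> A" for a
    unfolding cell_def M_def using rank_in_less_card[OF assms(1) that] by (intro div_le_mono) auto
  have cell_mono: "cell a \<le> cell b" if "a \<le> b" for a b
    unfolding cell_def using rank_in_mono[OF assms(1) that] by (intro div_le_mono) auto
  let ?X = "line_pts A z c"
  have "g ` ?X \<subseteq> {0..2 * M}"
  proof clarify
    fix x assume "x \<in> ?X"
    then have "cell x \<le> M" "cell (z * x + c) \<le> M"
      by (auto simp: line_pts_def intro!: cell_le)
    then show "g x \<in> {0..2 * M}" by (auto simp: g_def)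
  qed
  then have "card (g ` ?X) \<le> card {0..2 * M}"
    by (rule card_mono[rotated]) simp
  then have gcard: "card (g ` ?X) \<le> 2 * M + 1" by simp
  have "{x \<in> ?X. \<exists>x'\<in>?X. x < x' \<and> g x = g x'} \<subseteq>
    {x \<in> ?X. \<exists>x'\<in>?X. x < x' \<and> cell x = cell x' \<and> cell (z * x + c) = cell (z * x' + c)}"
  proof clarify
    fix x x' assume x: "x \<in> ?X" "x' \<in> ?X" "x < x'" "g x = g x'"
    have 1: "cell x \<le> cell x'" using x by (intro cell_mono) auto
    \<comment> \<open>These bounds keep the truncated subtraction in \<open>g\<close> injective in
      the second index.\<close>
    have 2: "cell (z * x + c) \<le> M" "cell (z * x' + c) \<le> M"
      using x by (auto simp: line_pts_def intro!: cell_le)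
    have "cell x = cell x' \<and> cell (z * x + c) = cell (z * x' + c)"
    proof (cases "z \<ge> 0")
      case True
      then have "cell (z * x + c) \<le> cell (z * x' + c)"
        using x by (intro cell_mono) (auto intro: mult_left_mono)
      then show ?thesis using 1 x(4) True by (auto simp: g_def)
    next
      case False
      then have "cell (z * x' + c) \<le> cell (z * x + c)"
        using x by (intro cell_mono) (auto intro: mult_left_mono_neg)
      then show ?thesis using 1 2 x(4) False by (auto simp: g_def)
    qed
    then show "\<exists>x'\<in>?X. x < x' \<and> cell x = cell x' \<and> cell (z * x + c) = cell (z * x' + c)"
      using x by blast
  qed
  then have "card {x \<in> ?X. \<exists>x'\<in>?X. x < x' \<and> g x = g x'} \<le>
    card {x \<in> ?X. \<exists>x'\<in>?X. x < x' \<and> cell x = cell x' \<and> cell (z * x + c) = cell (z * x' + c)}"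
    by (rule card_mono[rotated]) (simp add: assms(1))
  with card_nonmaximal_in_fibre[of ?X g] gcard assms(1) show ?thesis
    unfolding cell_def by simp
qed

section \<open>Rich lines: a Szemeredi-Trotter bound for grids\<close>

text \<open>Double counting of pairs of distinct points in a common cell: each line of
  \<open>Q\<close> supplies at least \<open>k - (2 * M + 1)\<close> of them, a pair determines its
  line, and at most \<open>(card A * m) ^ 2\<close> pairs share a cell.\<close>

lemma rich_lines_cells:
  assumes fin: "finite A" "finite Q" and m: "m > 0"
    and rich: "\<And>z c. (z, c) \<in> Q \<Longrightarrow> k \<le> card (line_pts A z c)"
  shows "card Q * (k - (2 * ((card A - 1) div m) + 1)) \<le> card A ^ 2 * m ^ 2"
proof -
  define cell where "cell = (\<lambda>a. rank_in A a div m)"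
  define M where "M = (card A - 1) div m"
  define P where "P = (\<lambda>z c x x'. x' \<in> line_pts A z c \<and> x < x' \<and> cell x = cell x'
     \<and> cell (z * x + c) = cell (z * x' + c))"
  define G where "G = (\<lambda>(z, c). {x \<in> line_pts A z c. \<exists>x'. P z c x x'})"
  \<comment> \<open>One partner is fixed per point, so each element of \<open>G (z, c)\<close>
    yields one pair.\<close>
  define w where "w = (\<lambda>z c x. SOME x'. P z c x x')"
  define T where "T = {(x, x') \<in> A \<times> A. cell x = cell x'}"
  have finG: "finite (G q)" for q
    using fin by (auto simp: G_def split: prod.split)
  have wP: "P z c x (w z c x)" if "x \<in> G (z, c)" for z c x
    using that unfolding w_def G_def by (auto intro: someI)
  have "k - (2 * M + 1) \<le> card (G q)" if "q \<in> Q" for q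
  proof -
    obtain z c where q: "q = (z, c)" by force
    have "G q = {x \<in> line_pts A z c. \<exists>x'\<in>line_pts A z c. x < x'
           \<and> rank_in A x div m = rank_in A x' div m
           \<and> rank_in A (z * x + c) div m = rank_in A (z * x' + c) div m}"
      by (auto simp: G_def P_def q cell_def)
    then show ?thesis
      using same_cell_points_on_line[OF fin(1), of z c m] rich[of z c] that q
      by (simp add: M_def)
  qed
  then have "card Q * (k - (2 * M + 1)) \<le> (\<Sum>q\<in>Q. card (G q))"
    using sum_mono[of Q "\<lambda>_. k - (2 * M + 1)" "\<lambda>q. card (G q)"] by simp
  also have "\<dots> = card (Sigma Q G)"
    using fin finG by simp
  also have "\<dots> \<le> card (T \<times> T)"
  proof (rule card_inj_on_le)
    \<comment> \<open>The pair of points is regrouped by axis: abscissas in one factor and ordinates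
      in the other, each a same-cell pair in \<open>T\<close>.\<close>
    let ?f = "\<lambda>((z, c), x). ((x, w z c x), (z * x + c, z * w z c x + c))"
    show "inj_on ?f (Sigma Q G)"
    proof (rule inj_onI)
      fix p p' assume p: "p \<in> Sigma Q G" "p' \<in> Sigma Q G" "?f p = ?f p'"
      obtain z c x z' c' x' where [simp]: "p = ((z, c), x)" "p' = ((z', c'), x')"
        by (metis surj_pair)
      define y where "y = w z c x"
      have e: "x' = x" "z * x + c = z' * x + c'" "z * y + c = z' * y + c'"
        using p(3) by (auto simp: y_def)
      have "x < y" using wP[of x z c] p(1) by (simp add: P_def y_def)
      moreover have "(z - z') * (y - x) = 0"
        using e by (simp add: algebra_simps)
      ultimately show "p = p'" using e by simp
    qed
    show "?f ` Sigma Q G \<subseteq> T \<times> T"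
    proof (rule image_subsetI)
      fix p assume "p \<in> Sigma Q G"
      then obtain z c x where "p = ((z, c), x)" "x \<in> G (z, c)" by auto
      then show "?f p \<in> T \<times> T"
        using wP[of x z c] by (auto simp: T_def P_def G_def line_pts_def)
    qed
    show "finite (T \<times> T)"
      using fin by (auto simp: T_def intro: finite_subset[of _ "A \<times> A"])
  qed
  also have "\<dots> \<le> (card A * m) * (card A * m)"
    unfolding card_cartesian_product T_def cell_def
    by (intro mult_mono card_same_cell_pairs fin m) auto
  finally show ?thesis
    by (simp add: M_def power2_eq_square mult_ac)
qed

text \<open>The cell size is chosen so that the loss \<open>2 * M + 1\<close> is at most half of
  \<open>k\<close>, while the same-cell pairs still number only O(|A|^4 / k^2).\<close>

lemma rich_lines:
  assumes fin: "finite A" "finite Q" and k: "k \<ge> 2"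
    and rich: "\<And>z c. (z, c) \<in> Q \<Longrightarrow> k \<le> card (line_pts A z c)"
  shows "card Q * k ^ 3 \<le> 512 * card A ^ 4"
proof (cases "Q = {}")
  case False
  then obtain z c where "(z, c) \<in> Q" by fastforce
  then have kn: "k \<le> card A"
    using rich card_line_pts_le[OF fin(1)] order_trans by blast
  show ?thesis
  proof (cases "k < 8")
    case True
    \<comment> \<open>For small \<open>k\<close> a single cell is enough: only one point per line is
      lost, and \<open>8 ^ 3 = 512\<close> absorbs the powers of \<open>k\<close>.\<close>
    have "(card A - 1) div card A = 0"
      using k kn by simp
    then have "card Q * (k - 1) \<le> card A ^ 2 * card A ^ 2"
      using rich_lines_cells[OF fin, of "card A" k] k kn rich by auto
    then have Q: "card Q * (k - 1) \<le> card A ^ 4" by (simp flip: power_add)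
    have "k ^ 3 \<le> 8 ^ 3"
      using True by (intro power_mono) auto
    then have "k ^ 3 \<le> 512 * (k - 1)"
      using k by simp
    then have "card Q * k ^ 3 \<le> card Q * (512 * (k - 1))" by simp
    also have "\<dots> \<le> 512 * card A ^ 4" using Q by simp
    finally show ?thesis .
  next
    case False
    define n where "n = card A"
    \<comment> \<open>Blocks of size \<open>16 * q\<close> number about k/16 per axis. The largest
      block index \<open>D\<close> satisfies \<open>16 * q * D \<le> n - 1 < 2 * q * k\<close>, so
      \<open>8 * D < k\<close> and at least half of the \<open>k\<close> points survive.\<close>
    define q where "q = n div k"
    have q: "q \<ge> 1" using kn k by (simp add: q_def n_def div_greater_zero_iff Suc_le_eq)
    have qk: "q * k \<le> n" by (simp add: q_def)
    have "n < (q + 1) * k"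
      using k by (simp add: q_def dividend_less_div_times add.commute)
    also have "\<dots> \<le> 2 * q * k" using q by (intro mult_right_mono) auto
    finally have n2: "n < 2 * q * k" .
    define D where "D = (n - 1) div (16 * q)"
    have "D * (16 * q) \<le> n - 1" by (simp add: D_def)
    moreover have "D * (16 * q) = 2 * (q * (8 * D))" "2 * q * k = 2 * (q * k)" by simp_all
    ultimately have "q * (8 * D) < q * k" using n2 by linarith
    then have "8 * D < k" by simp
    then have D: "k \<le> 2 * (k - (2 * D + 1))" using False by simp
    have "card Q * (k - (2 * D + 1)) \<le> n\<^sup>2 * (16 * q)\<^sup>2"
      using rich_lines_cells[OF fin, of "16 * q" k] q rich by (auto simp: n_def D_def)
    \<comment> \<open>Here 512 is \<open>2 * 16 ^ 2\<close>, the 2 coming from the halving of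
      \<open>k\<close>.\<close>
    then have 1: "card Q * (2 * (k - (2 * D + 1))) \<le> 512 * (n\<^sup>2 * q\<^sup>2)"
      by (simp add: power_mult_distrib)
    have "card Q * k \<le> 512 * (n\<^sup>2 * q\<^sup>2)"
      by (rule order_trans[OF _ 1]) (intro mult_left_mono D, simp)
    then have "card Q * k * k\<^sup>2 \<le> 512 * (n\<^sup>2 * q\<^sup>2) * k\<^sup>2"
      by (intro mult_right_mono) auto
    also have "\<dots> = 512 * (n\<^sup>2 * (q * k)\<^sup>2)" by (simp add: power_mult_distrib)
    also have "\<dots> \<le> 512 * (n\<^sup>2 * n\<^sup>2)"
      by (intro mult_left_mono power_mono qk) auto
    finally show ?thesis
      by (simp add: n_def power2_eq_square power3_eq_cube power4_eq_xxxx mult_ac)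
  qed
qed simp

section \<open>Third moment of the incidence counts\<close>

text \<open>Telescoping: consecutive cubes differ by \<open>3 * n^2 + 3 * n + 1\<close>, which is at
  most \<open>3 * (n + 1)^2\<close>.\<close>

lemma cube_le_sum_squares: "real n ^ 3 \<le> (\<Sum>k=1..n. 3 * real k ^ 2)"
proof (induction n)
  case (Suc n)
  have "real (Suc n) ^ 3 \<le> real n ^ 3 + 3 * real (Suc n) ^ 2"
    by (simp add: power2_eq_square power3_eq_cube algebra_simps)
  with Suc show ?case by simp
qed simp

text \<open>Layer-cake summation: level \<open>k\<close> contributes at most
  \<open>3 * k^2 * (H / k^3) = 3 * H / k\<close>. This harmonic sum is the source of the
  logarithm.\<close>

lemma sum_cubes_le_harm:
  fixes f :: "'a \<Rightarrow> nat"
  assumes fin: "finite S" and le: "\<And>s. s \<in> S \<Longrightarrow> f s \<le> n"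
    and tail: "\<And>k. k \<ge> 1 \<Longrightarrow> real (card {s \<in> S. k \<le> f s}) * real k ^ 3 \<le> H"
  shows "(\<Sum>s\<in>S. real (f s) ^ 3) \<le> 3 * H * harm n"
proof -
  have "(\<Sum>s\<in>S. real (f s) ^ 3) \<le> (\<Sum>s\<in>S. \<Sum>k=1..n. if k \<le> f s then 3 * real k ^ 2 else 0)"
  proof (rule sum_mono)
    fix s assume "s \<in> S"
    then have eq: "{1..f s} = {k \<in> {1..n}. k \<le> f s}" using le[of s] by auto
    have "(\<Sum>k=1..f s. 3 * real k ^ 2) = (\<Sum>k=1..n. if k \<le> f s then 3 * real k ^ 2 else 0)"
      unfolding eq by (rule sum.inter_filter) simp
    then show "real (f s) ^ 3 \<le> (\<Sum>k=1..n. if k \<le> f s then 3 * real k ^ 2 else 0)"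
      using cube_le_sum_squares[of "f s"] by simp
  qed
  also have "\<dots> = (\<Sum>k=1..n. \<Sum>s\<in>S. if k \<le> f s then 3 * real k ^ 2 else 0)"
    by (rule sum.swap)
  also have "\<dots> = (\<Sum>k=1..n. real (card {s \<in> S. k \<le> f s}) * (3 * real k ^ 2))"
    using fin by (simp flip: sum.inter_filter)
  also have "\<dots> \<le> (\<Sum>k=1..n. 3 * H * inverse (real k))"
  proof (rule sum_mono)
    fix k assume "k \<in> {1..n}"
    then show "real (card {s \<in> S. k \<le> f s}) * (3 * real k ^ 2) \<le> 3 * H * inverse (real k)"
      using tail[of k] by (simp add: field_simps power2_eq_square power3_eq_cube)
  qed
  also have "\<dots> = 3 * H * harm n"
    by (simp add: harm_def sum_distrib_left)
  finally show ?thesis .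
qed

text \<open>The sequence \<open>harm n - ln n\<close> decreases from its value 1 at
  \<open>n = 1\<close>.\<close>

lemma harm_le_one_plus_ln: "n \<ge> 1 \<Longrightarrow> harm n \<le> 1 + ln (real n)"
  using euler_mascheroni_sequence_decreasing[of 1 n] by (simp add: harm_def)

text \<open>In the tail bound, \<open>h\<close> pays for the lines with at least one point and 512
  for the richer ones. The size of \<open>D\<close> does not enter, since lines missing the grid
  contribute zero.\<close>

lemma third_moment:
  assumes fin: "finite A" "finite Z" "finite D"
    and h: "real (card Z) \<le> h * real (card A) ^ 2"
  shows "(\<Sum>(z, c)\<in>Z \<times> D. real (card (line_pts A z c)) ^ 3)
     \<le> 3 * ((512 + h) * real (card A) ^ 4) * harm (card A)"
proof -
  let ?f = "\<lambda>(z, c). card (line_pts A z c)"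
  have "(\<Sum>q\<in>Z \<times> D. real (?f q) ^ 3) \<le> 3 * ((512 + h) * real (card A) ^ 4) * harm (card A)"
  proof (rule sum_cubes_le_harm)
    fix k :: nat assume k: "k \<ge> 1"
    let ?Q = "{q \<in> Z \<times> D. k \<le> ?f q}"
    have finQ: "finite ?Q" using fin by simp
    \<comment> \<open>No sign of \<open>h\<close> is assumed; the product is nonnegative because it
      dominates \<open>card Z * card A ^ 2\<close>.\<close>
    have hA: "0 \<le> h * real (card A) ^ 4" "h * real (card A) ^ 4 \<ge> real (card Z) * real (card A) ^ 2"
    proof -
      have "real (card Z) * real (card A) ^ 2 \<le> h * real (card A) ^ 2 * real (card A) ^ 2"
        using h by (intro mult_right_mono) auto
      then show *: "h * real (card A) ^ 4 \<ge> real (card Z) * real (card A) ^ 2"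
        by (simp add: mult.assoc flip: power_add)
      show "0 \<le> h * real (card A) ^ 4"
        by (rule order_trans[OF _ *]) simp
    qed
    show "real (card ?Q) * real k ^ 3 \<le> (512 + h) * real (card A) ^ 4"
    proof (cases "k = 1")
      case True
      \<comment> \<open>A line is determined by its slope and one grid point on it.\<close>
      have "?Q \<subseteq> (\<lambda>(z, a, b). (z, a - z * b)) ` (Z \<times> A \<times> A)"
      proof clarify
        fix z c assume "z \<in> Z" "k \<le> card (line_pts A z c)"
        then have "line_pts A z c \<noteq> {}" using True by auto
        then obtain b where "b \<in> A" "z * b + c \<in> A" by (auto simp: line_pts_def)
        then show "(z, c) \<in> (\<lambda>(z, a, b). (z, a - z * b)) ` (Z \<times> A \<times> A)"
          using \<open>z \<in> Z\<close> by (intro image_eqI[of _ _ "(z, z * b + c, b)"]) auto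
      qed
      then have "card ?Q \<le> card (Z \<times> A \<times> A)"
        using fin by (intro surj_card_le) auto
      then have "real (card ?Q) \<le> real (card Z) * real (card A) ^ 2"
        by (simp add: power2_eq_square card_cartesian_product flip: of_nat_mult)
      moreover have "0 \<le> real (card A) ^ 4" by simp
      ultimately have "real (card ?Q) \<le> (512 + h) * real (card A) ^ 4"
        using hA unfolding distrib_right by linarith
      then show ?thesis using True by simp
    next
      case False
      have "card ?Q * k ^ 3 \<le> 512 * card A ^ 4"
        using k False by (intro rich_lines fin finQ) auto
      then have "real (card ?Q * k ^ 3) \<le> real (512 * card A ^ 4)"
        by (rule of_nat_mono)
      then show ?thesis using hA by (simp add: algebra_simps)
    qed
  qed (use fin card_line_pts_le in auto)
  then show ?thesis by (simp add: case_prod_unfold)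
qed

section \<open>Quotient representations as incidences\<close>

text \<open>Lines of equal slope are disjoint: the grid point \<open>(b, a)\<close> fixes the
  intercept \<open>a - z * b\<close>.\<close>

lemma sum_card_line_pts_le:
  assumes "finite A" "finite D"
  shows "(\<Sum>c\<in>D. card (line_pts A z c)) \<le> card A ^ 2"
proof -
  have "(\<Sum>c\<in>D. card (line_pts A z c)) = card (SIGMA c:D. line_pts A z c)"
    using assms by simp
  also have "\<dots> \<le> card (A \<times> A)"
    by (rule card_inj_on_le[of "\<lambda>(c, b). (b, z * b + c)"])
       (auto simp: inj_on_def line_pts_def assms)
  finally show ?thesis by (simp add: power2_eq_square card_cartesian_product)
qed

definition quotient_reps :: "real set \<Rightarrow> real set \<Rightarrow> real \<Rightarrow> (real \<times> real \<times> real \<times> real) set" where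
  "quotient_reps A B z = {(a, a', b, b') \<in> A \<times> B \<times> A \<times> B. a + a' = z * (b + b')}"

lemma Rcount_le_sum_squares:
  assumes "finite A1" "finite A2" "finite Z"
  shows "Rcount Z A1 A2 \<le> (\<Sum>z\<in>Z. card (quotient_reps A1 A2 z) ^ 2)"
proof -
  let ?q = "quotient_reps A1 A2"
  have finq: "finite (?q z)" for z
    unfolding quotient_reps_def
    by (rule finite_subset[of _ "A1 \<times> A2 \<times> A1 \<times> A2"]) (use assms in auto)
  let ?S = "SIGMA z:Z. ?q z \<times> ?q z"
  have "Rcount Z A1 A2 \<le> card ?S"
    unfolding Rcount_def
  proof (rule surj_card_le)
    show "finite ?S" using assms finq by auto
    show "{(a1, a2, b1, b2, c1, c2, d1, d2).
        a1 \<in> A1 \<and> a2 \<in> A2 \<and> b1 \<in> A1 \<and> b2 \<in> A2 \<and>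
        c1 \<in> A1 \<and> c2 \<in> A2 \<and> d1 \<in> A1 \<and> d2 \<in> A2 \<and>
        b1 + b2 \<noteq> 0 \<and> d1 + d2 \<noteq> 0 \<and>
        (a1 + a2) / (b1 + b2) = (c1 + c2) / (d1 + d2) \<and> (a1 + a2) / (b1 + b2) \<in> Z}
      \<subseteq> (\<lambda>(z, (a1, a2, b1, b2), (c1, c2, d1, d2)). (a1, a2, b1, b2, c1, c2, d1, d2)) ` ?S"
    proof clarify
      fix a1 a2 b1 b2 c1 c2 d1 d2
      assume "a1 \<in> A1" "a2 \<in> A2" "b1 \<in> A1" "b2 \<in> A2" "c1 \<in> A1" "c2 \<in> A2" "d1 \<in> A1" "d2 \<in> A2"
        and nz: "b1 + b2 \<noteq> 0" "d1 + d2 \<noteq> 0"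
        and eq: "(a1 + a2) / (b1 + b2) = (c1 + c2) / (d1 + d2)" and Z: "(a1 + a2) / (b1 + b2) \<in> Z"
      moreover have "a1 + a2 = (a1 + a2) / (b1 + b2) * (b1 + b2)" using nz by simp
      moreover have "c1 + c2 = (a1 + a2) / (b1 + b2) * (d1 + d2)" using nz eq by simp
      ultimately show "(a1, a2, b1, b2, c1, c2, d1, d2) \<in>
        (\<lambda>(z, (a1, a2, b1, b2), (c1, c2, d1, d2)). (a1, a2, b1, b2, c1, c2, d1, d2)) ` ?S"
        by (intro image_eqI[of _ _ "((a1 + a2) / (b1 + b2), (a1, a2, b1, b2), (c1, c2, d1, d2))"])
           (simp_all add: quotient_reps_def)
    qed
  qed
  also have "card ?S = (\<Sum>z\<in>Z. card (?q z) ^ 2)"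
    using assms finq by (simp add: card_cartesian_product power2_eq_square)
  finally show ?thesis .
qed

text \<open>The equation reads \<open>a - z * b = - a' - z * (- b')\<close>: the points
  \<open>(b, a)\<close> and \<open>(- b', - a')\<close> lie on the same line of slope
  \<open>z\<close>, whose intercept \<open>c\<close> indexes the sum.\<close>

lemma card_quotient_reps_le:
  assumes "finite A" "finite B" "finite D" and D: "\<And>a b. a \<in> A \<Longrightarrow> b \<in> A \<Longrightarrow> a - z * b \<in> D"
  shows "card (quotient_reps A B z)
    \<le> (\<Sum>c\<in>D. card (line_pts A z c) * card (line_pts (uminus ` B) z c))"
proof -
  let ?S = "SIGMA c:D. line_pts A z c \<times> line_pts (uminus ` B) z c"
  have "card (quotient_reps A B z) \<le> card ?S"
  proof (rule surj_card_le)
    show "finite ?S" using assms by auto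
    show "quotient_reps A B z \<subseteq> (\<lambda>(c, b, b'). (z * b + c, - (z * b' + c), b, - b')) ` ?S"
    proof clarify
      fix a a' b b' assume "(a, a', b, b') \<in> quotient_reps A B z"
      then have *: "a \<in> A" "a' \<in> B" "b \<in> A" "b' \<in> B" "a + a' = z * (b + b')"
        by (auto simp: quotient_reps_def)
      then have "- a' = z * (- b') + (a - z * b)" by (simp add: algebra_simps)
      moreover from this have "z * (- b') + (a - z * b) \<in> uminus ` B" using *(2) by (metis imageI)
      ultimately show "(a, a', b, b') \<in> (\<lambda>(c, b, b'). (z * b + c, - (z * b' + c), b, - b')) ` ?S"
        using * D[of a b]
        by (intro image_eqI[of _ _ "(a - z * b, b, - b')"]) (auto simp: line_pts_def)
    qed
  qed
  also have "card ?S = (\<Sum>c\<in>D. card (line_pts A z c) * card (line_pts (uminus ` B) z c))"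
    using assms by (simp add: card_cartesian_product)
  finally show ?thesis .
qed

section \<open>Cauchy-Schwarz and a Hoelder-type inequality\<close>

lemma sum_mult_squared_le:
  fixes f g :: "'a \<Rightarrow> real"
  assumes "\<And>c. c \<in> D \<Longrightarrow> f c \<ge> 0"
  shows "(\<Sum>c\<in>D. f c * g c) ^ 2 \<le> (\<Sum>c\<in>D. f c) * (\<Sum>c\<in>D. f c * g c ^ 2)"
proof -
  have "(\<Sum>c\<in>D. f c * g c) = (\<Sum>c\<in>D. sqrt (f c) * (sqrt (f c) * g c))"
    using assms by (intro sum.cong) (auto simp flip: mult.assoc)
  also have "\<dots> ^ 2 \<le> (\<Sum>c\<in>D. sqrt (f c) ^ 2) * (\<Sum>c\<in>D. (sqrt (f c) * g c) ^ 2)"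
    by (rule Cauchy_Schwarz_ineq_sum)
  also have "\<dots> = (\<Sum>c\<in>D. f c) * (\<Sum>c\<in>D. f c * g c ^ 2)"
    using assms by (simp add: power_mult_distrib)
  finally show ?thesis .
qed

text \<open>The cube of the larger variable alone dominates the product.\<close>

lemma mult_square_le_sum_cubes:
  fixes u v :: real
  assumes "u \<ge> 0" "v \<ge> 0"
  shows "u * v ^ 2 \<le> u ^ 3 + v ^ 3"
proof (cases "u \<le> v")
  case True
  then have "u * v ^ 2 \<le> v * v ^ 2" by (intro mult_right_mono) auto
  then show ?thesis using assms by (simp add: power3_eq_cube power2_eq_square add_increasing)
next
  case False
  then have "u * v ^ 2 \<le> u * u ^ 2" using assms by (intro mult_left_mono power_mono) auto
  then show ?thesis using assms by (simp add: power3_eq_cube power2_eq_square add_increasing2)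
qed

text \<open>Hoelder with exponents 3 and 3/2 up to a factor 2: after scaling \<open>f\<close> by
  \<alpha> and \<open>g\<close> by \<beta>, the pointwise bound by cubes is summed.\<close>

lemma sum_mult_square_le:
  fixes f g :: "'a \<Rightarrow> real"
  assumes nn: "\<And>s. s \<in> S \<Longrightarrow> f s \<ge> 0" "\<And>s. s \<in> S \<Longrightarrow> g s \<ge> 0" and pos: "\<alpha> > 0" "\<beta> > 0"
    and f: "(\<Sum>s\<in>S. f s ^ 3) \<le> B * \<alpha> ^ 3" and g: "(\<Sum>s\<in>S. g s ^ 3) \<le> B * \<beta> ^ 3"
  shows "(\<Sum>s\<in>S. f s * g s ^ 2) \<le> 2 * B * \<alpha> * \<beta> ^ 2"
proof -
  have "(\<Sum>s\<in>S. f s * g s ^ 2)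
     \<le> (\<Sum>s\<in>S. (\<alpha> * \<beta> ^ 2) * (f s ^ 3 / \<alpha> ^ 3 + g s ^ 3 / \<beta> ^ 3))"
  proof (rule sum_mono)
    fix s assume "s \<in> S"
    then have "(\<alpha> * \<beta> ^ 2) * ((f s / \<alpha>) * (g s / \<beta>) ^ 2)
       \<le> (\<alpha> * \<beta> ^ 2) * ((f s / \<alpha>) ^ 3 + (g s / \<beta>) ^ 3)"
      using nn pos by (intro mult_left_mono mult_square_le_sum_cubes) auto
    then show "f s * g s ^ 2 \<le> (\<alpha> * \<beta> ^ 2) * (f s ^ 3 / \<alpha> ^ 3 + g s ^ 3 / \<beta> ^ 3)"
      using pos by (simp add: power_divide)
  qed
  also have "\<dots> = (\<alpha> * \<beta> ^ 2) * ((\<Sum>s\<in>S. f s ^ 3) / \<alpha> ^ 3 + (\<Sum>s\<in>S. g s ^ 3) / \<beta> ^ 3)"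
    by (simp add: sum.distrib sum_divide_distrib flip: sum_distrib_left)
  also have "\<dots> \<le> (\<alpha> * \<beta> ^ 2) * (B + B)"
    using f g pos by (intro mult_left_mono add_mono) (auto simp: divide_le_eq)
  finally show ?thesis by (simp add: algebra_simps)
qed

section \<open>The bound with explicit dependence on \<open>h\<close>\<close>

lemma Rcount_le:
  assumes fin: "finite A1" "finite A2" "finite Z" and ne: "card A1 > 0" and le: "card A1 \<le> card A2"
    and h: "real (card Z) \<le> h * real (card A1) ^ 2"
  shows "real (Rcount Z A1 A2)
    \<le> 6 * (512 + h) * harm (card A2) * real (card A1) powr (10/3) * real (card A2) powr (8/3)"
proof -
  \<comment> \<open>All intercepts of lines with slope in \<open>Z\<close> through a point of
    \<open>A1 \<times> A1\<close>.\<close>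
  define D where "D = (\<lambda>(z, a, b). a - z * b) ` (Z \<times> A1 \<times> A1)"
  have finD: "finite D" using fin by (simp add: D_def)
  define f where "f = (\<lambda>z c. real (card (line_pts A1 z c)))"
  define g where "g = (\<lambda>z c. real (card (line_pts (uminus ` A2) z c)))"
  \<comment> \<open>The scales are the cube roots of \<open>card A1 ^ 4\<close> and
    \<open>card A2 ^ 4\<close>, the sizes of the third moments.\<close>
  define \<alpha> where "\<alpha> = real (card A1) powr (4/3)"
  define \<beta> where "\<beta> = real (card A2) powr (4/3)"
  define B where "B = 3 * (512 + h) * harm (card A2)"
  have pos: "real (card A1) > 0" "real (card A2) > 0" using ne le by auto
  have ab: "\<alpha> > 0" "\<beta> > 0" using pos by (auto simp: \<alpha>_def \<beta>_def)
  have ab3: "\<alpha> ^ 3 = real (card A1) ^ 4" "\<beta> ^ 3 = real (card A2) ^ 4"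
    using pos by (auto simp: \<alpha>_def \<beta>_def powr_power)
  have card_neg: "card (uminus ` A2) = card A2" by (rule card_image) (simp add: inj_on_def)
  have h0: "h \<ge> 0"
  proof -
    have "0 \<le> h * real (card A1) ^ 2" by (rule order_trans[OF _ h]) simp
    then show ?thesis using pos by (simp add: zero_le_mult_iff)
  qed
  \<comment> \<open>The hypothesis passes to the larger set, so both third moments are bounded with
    the same \<open>h\<close>.\<close>
  have "real (card Z) \<le> h * real (card A2) ^ 2"
    by (rule order_trans[OF h]) (use h0 le in \<open>auto intro!: mult_left_mono power_mono\<close>)
  then have g3: "(\<Sum>(z, c)\<in>Z \<times> D. g z c ^ 3) \<le> B * \<beta> ^ 3"
    using third_moment[of "uminus ` A2" Z D h] fin finD
    by (simp add: g_def B_def ab3 card_neg algebra_simps)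
  have "(\<Sum>(z, c)\<in>Z \<times> D. f z c ^ 3) \<le> 3 * ((512 + h) * real (card A1) ^ 4) * harm (card A1)"
    unfolding f_def by (rule third_moment[OF fin(1,3) finD h])
  also have "\<dots> \<le> 3 * ((512 + h) * real (card A1) ^ 4) * harm (card A2)"
    using h0 le by (intro mult_left_mono harm_mono) auto
  finally have f3: "(\<Sum>(z, c)\<in>Z \<times> D. f z c ^ 3) \<le> B * \<alpha> ^ 3"
    by (simp add: B_def ab3 algebra_simps)
  have "real (Rcount Z A1 A2) \<le> (\<Sum>z\<in>Z. real (card (quotient_reps A1 A2 z)) ^ 2)"
    using of_nat_mono[OF Rcount_le_sum_squares[OF fin], where ?'a = real] by simp
  \<comment> \<open>Taking \<open>f\<close> as the Cauchy-Schwarz weight puts the factor on the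
    smaller set: \<open>card A1 ^ 2\<close>, not \<open>card A2 ^ 2\<close>.\<close>
  also have "\<dots> \<le> (\<Sum>z\<in>Z. real (card A1) ^ 2 * (\<Sum>c\<in>D. f z c * g z c ^ 2))"
  proof (rule sum_mono)
    fix z assume z: "z \<in> Z"
    have "a - z * b \<in> D" if "a \<in> A1" "b \<in> A1" for a b
      using z that by (auto simp: D_def intro!: image_eqI[of _ _ "(z, a, b)"])
    from of_nat_mono[OF card_quotient_reps_le[OF fin(1,2) finD this], where ?'a = real]
    have "real (card (quotient_reps A1 A2 z)) \<le> (\<Sum>c\<in>D. f z c * g z c)"
      by (simp add: f_def g_def)
    then have "real (card (quotient_reps A1 A2 z)) ^ 2 \<le> (\<Sum>c\<in>D. f z c * g z c) ^ 2"
      by (intro power_mono) auto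
    also have "\<dots> \<le> (\<Sum>c\<in>D. f z c) * (\<Sum>c\<in>D. f z c * g z c ^ 2)"
      by (rule sum_mult_squared_le) (simp add: f_def)
    also have "\<dots> \<le> real (card A1) ^ 2 * (\<Sum>c\<in>D. f z c * g z c ^ 2)"
    proof (rule mult_right_mono)
      show "(\<Sum>c\<in>D. f z c) \<le> real (card A1) ^ 2"
        using of_nat_mono[OF sum_card_line_pts_le[OF fin(1) finD, of z], where ?'a = real]
        by (simp add: f_def)
    qed (auto intro!: sum_nonneg simp: f_def)
    finally show "real (card (quotient_reps A1 A2 z)) ^ 2 \<le> \<dots>" .
  qed
  also have "\<dots> = real (card A1) ^ 2 * (\<Sum>(z, c)\<in>Z \<times> D. f z c * g z c ^ 2)"
    by (simp add: sum.cartesian_product flip: sum_distrib_left)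
  also have "\<dots> \<le> real (card A1) ^ 2 * (2 * B * \<alpha> * \<beta> ^ 2)"
  proof (rule mult_left_mono)
    show "(\<Sum>(z, c)\<in>Z \<times> D. f z c * g z c ^ 2) \<le> 2 * B * \<alpha> * \<beta> ^ 2"
      using sum_mult_square_le[of "Z \<times> D" "case_prod f" "case_prod g" \<alpha> \<beta> B] ab f3 g3
      by (simp add: case_prod_unfold f_def g_def)
  qed simp
  also have "\<dots> = 6 * (512 + h) * harm (card A2) * (real (card A1) ^ 2 * \<alpha>) * \<beta> ^ 2"
    by (simp add: B_def)
  also have "real (card A1) ^ 2 * \<alpha> = real (card A1) powr 2 * real (card A1) powr (4/3)"
    by (simp add: \<alpha>_def)
  also have "\<dots> = real (card A1) powr (10/3)"
    unfolding powr_add[symmetric] by simp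
  also have "\<beta> ^ 2 = real (card A2) powr (8/3)"
    using pos by (simp add: \<beta>_def powr_power)
  finally show ?thesis .
qed

section \<open>Absorbing the harmonic number into the logarithms\<close>

theorem mainTheorem2:
  fixes C0 c0 :: real
  assumes "C0 > 0" and "c0 > 0"
  shows "\<exists>C c :: real. C > 0 \<and> c > 0 \<and>
    (\<forall>A1 A2 Z :: real set. finite A1 \<longrightarrow> finite A2 \<longrightarrow> finite Z \<longrightarrow>
       card A1 \<le> card A2 \<longrightarrow>
       real (card Z) \<le> C0 * real (card A1) ^ 2 * ln (2 + real (Max {card A1, card A2, card Z})) powr c0 \<longrightarrow>
       real (Rcount Z A1 A2) \<le> C * real (card A1) powr (10/3) * real (card A2) powr (8/3)
          * ln (2 + real (Max {card A1, card A2, card Z})) powr c)"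
proof (intro exI conjI allI impI)
  \<comment> \<open>The 12 is 6 times the 2 in \<open>harm (card A2) \<le> 2 * L\<close>; the
    harmonic number also adds 1 to the exponent.\<close>
  show "12 * (512 + C0) > 0" "c0 + 1 > 0" using assms by auto
  fix A1 A2 Z :: "real set"
  assume fin: "finite A1" "finite A2" "finite Z" and le: "card A1 \<le> card A2"
    and Z: "real (card Z) \<le> C0 * real (card A1) ^ 2 * ln (2 + real (Max {card A1, card A2, card Z})) powr c0"
  define L where "L = ln (2 + real (Max {card A1, card A2, card Z}))"
  show "real (Rcount Z A1 A2) \<le> 12 * (512 + C0) * real (card A1) powr (10/3) * real (card A2) powr (8/3)
          * ln (2 + real (Max {card A1, card A2, card Z})) powr (c0 + 1)"
  proof (cases "card A1 = 0")
    case True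
    then have "A1 = {}" using fin by simp
    then have "quotient_reps A1 A2 z = {}" for z by (auto simp: quotient_reps_def)
    then have "Rcount Z A1 A2 = 0"
      using Rcount_le_sum_squares[OF fin] by simp
    then show ?thesis using assms by simp
  next
    case False
    define N where "N = Max {card A1, card A2, card Z}"
    have A2: "card A2 > 0" "card A2 \<le> N" using False le by (auto simp: N_def)
    \<comment> \<open>Since \<open>N \<ge> 1\<close>, the argument is at least 3, hence
      \<open>L \<ge> 1\<close> and powers of \<open>L\<close> can absorb constants.\<close>
    then have "exp 1 \<le> 2 + real N" using exp_le by linarith
    then have "ln (exp 1) \<le> ln (2 + real N)" by (subst ln_le_cancel_iff) auto
    then have L1: "L \<ge> 1" by (simp add: L_def N_def)
    have "ln (real (card A2)) \<le> ln (2 + real N)"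
      using A2 by (subst ln_le_cancel_iff) auto
    then have "ln (real (card A2)) \<le> L" by (simp add: L_def N_def)
    moreover have "harm (card A2) \<le> 1 + ln (real (card A2))"
      using False le by (intro harm_le_one_plus_ln) linarith
    ultimately have harm: "harm (card A2) \<le> 2 * L" using L1 by linarith
    have Lp: "L powr c0 \<ge> 1" using L1 assms by (simp add: ge_one_powr_ge_zero)
    \<comment> \<open>The explicit bound is applied with \<open>h = C0 * L powr c0\<close>; next,
      512 is enlarged to \<open>512 * L powr c0\<close>.\<close>
    have "real (Rcount Z A1 A2) \<le> 6 * (512 + C0 * L powr c0) * harm (card A2)
        * real (card A1) powr (10/3) * real (card A2) powr (8/3)"
      using False Z by (intro Rcount_le fin le) (simp_all add: L_def mult_ac)
    also have "\<dots> \<le> 6 * ((512 + C0) * L powr c0) * (2 * L)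
        * real (card A1) powr (10/3) * real (card A2) powr (8/3)"
      using harm Lp L1 assms
      by (intro mult_mono mult_nonneg_nonneg harm_nonneg) (auto simp: algebra_simps)
    also have "\<dots> = 12 * (512 + C0) * real (card A1) powr (10/3) * real (card A2) powr (8/3)
        * L powr (c0 + 1)"
      using L1 by (simp add: powr_add)
    finally show ?thesis by (simp add: L_def)
  qed
qed

end
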